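(* Let $N,k,m,n$ be positive integers, $r>0$, $0<\epsilon\le\frac1N$, let $\boldsymbol{\xi}_1,\dots,\boldsymbol{\xi}_N\in\mathbb{R}^k$ be samples, and let $q_1:\mathbb{R}^n\to\mathbb{R}^{m+1}$, $R_1:\mathbb{R}^n\to\mathbb{R}^{(m+1)\times k}$ and $\underline{k}:\mathbb{R}^n\to\{1\}\times\mathbb{R}^m$ be smooth. Given $x\in\mathbb{R}^n$, define \begin{align*} &\hat Q(x)=\big(r+\epsilon\max_{i\in[N]}\|\boldsymbol{\xi}_i\|\big)R_1(x)_{2:(m+1)}\in\mathbb{R}^{m\times k},\qquad \hat r(x)=\big(r+\epsilon\max_{i\in[N]}\|\boldsymbol{\xi}_i\|\big)R_1(x)_1\in\mathbb{R}^{1\times k},\\ &\hat w(x)=-\epsilon\,q_1(x)_{2:(m+1)}\in\mathbb{R}^m,\qquad \hat v(x)=-\epsilon\,q_1(x)_1\in\mathbb{R},\\ &\hat F(x)=\hat Q(x)\hat Q(x)^T-\hat w(x)\hat w(x)^T\in\mathbb{R}^{m\times m},\qquad \hat J(x)=\hat r(x)\hat Q(x)^T-\hat v(x)\hat w(x)^T\in\mathbb{R}^{1\times m},\\ &\hat H(x)=\begin{pmatrix}\hat r(x)\hat r(x)^T-\hat v(x)^2 & \hat J(x)\\ \hat J(x)^T & \hat F(x)\end{pmatrix}\in\mathbb{R}^{(m+1)\times(m+1)}. \end{align*} Let $\hat\lambda(x)$ be the minimum eigenvalue of $\hat F(x)$. Suppose that $\hat Q(x)\hat Q(x)^T$ is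 invertible, $\hat H(x)$ is not positive definite, and one of the following holds: (i) $\hat\lambda(x)<0$; (ii) $\hat\lambda(x)>0$ and $\big(\hat v-\hat w^T\hat F^{-1}(\hat Q\hat r^T-\hat w\hat v)\big)(x)\ge 0$; (iii) $\hat\lambda(x)=0$ and $\big(\hat v-\hat w^T(\hat Q\hat Q^T)^{-1}\hat Q\hat r^T\big)(x)>0$. Then the DRO-SOCP with one constraint ($M=1$) is feasible at $x$.
   Context: Notation: $[N]=\{1,\dots,N\}$; $\|\cdot\|$ is the Euclidean norm; for a matrix (or column vector) $A$, $A_{i:j}$ is the matrix formed by rows $i$ to $j$ of $A$, and $A_1$ is its first row (first entry). Let $\underline{\mathcal U}=\{1\}\times\mathbb{R}^m$; elements are written $\underline u=[1;u]$ with $u\in\mathbb{R}^m$. Set $G_1(x,\underline u,\boldsymbol{\xi})=\underline u^Tq_1(x)+\underline u^TR_1(x)\boldsymbol{\xi}$ for $\boldsymbol{\xi}\in\mathbb{R}^k$. The DRO-SOCP with $M=1$ at $x\in\mathbb{R}^n$ is the problem \begin{align*} &\min_{\underline u\in\underline{\mathcal U},\,y\in\mathbb{R},\,t\in\mathbb{R},\,s_i\in\mathbb{R}}\ y\\ \text{s.t. }& r\|R_1(x)^T\underline u\|+\frac1N\sum_{i=1}^N s_i-t\epsilon\le 0,\\ & s_i\ge G_1(x,\underline u,\boldsymbol{\xi}_i)+t,\quad s_i\ge 0,\quad \forall i\in[N],\\ & y+1\ge\sqrt{\|2(\underline u-\underline k(x))\|^2+(y-1)^2}. \end{align*} It is feasible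 at $x$ if some choice of the variables satisfies all constraints. *)

theory Defs
  imports "HOL-Analysis.Analysis"
begin

(* R^(m+1) is rendered as real ^ 'm option: index None is the first entry/row, and the
   indices Some i are the entries/rows 2 to m+1. *)

definition tail_rows :: "'a ^ 'm::finite option \<Rightarrow> 'a ^ 'm" where
  "tail_rows A = (\<chi> i. A $ Some i)"

(* The set {1} x R^m *)
definition augmented_inputs :: "(real ^ 'm::finite option) set" where
  "augmented_inputs = {u. u $ None = 1}"

definition outer_prod :: "real ^ 'm \<Rightarrow> real ^ 'n \<Rightarrow> real ^ 'n ^ 'm" where
  "outer_prod v w = (\<chi> i j. v $ i * w $ j)"

(* The block matrix (a, b^T; b, C) *)
definition bordered_matrix ::
    "real \<Rightarrow> real ^ 'm \<Rightarrow> real ^ 'm ^ 'm::finite \<Rightarrow> real ^ 'm option ^ 'm option" where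
  "bordered_matrix a b C = (\<chi> i j.
     case i of
       None \<Rightarrow> (case j of None \<Rightarrow> a | Some l \<Rightarrow> b $ l)
     | Some k \<Rightarrow> (case j of None \<Rightarrow> b $ k | Some l \<Rightarrow> C $ k $ l))"

definition positive_definite :: "real ^ 'm ^ 'm \<Rightarrow> bool" where
  "positive_definite A \<longleftrightarrow> transpose A = A \<and> (\<forall>v. v \<noteq> 0 \<longrightarrow> v \<bullet> (A *v v) > 0)"

definition eigenvalues :: "real ^ 'm ^ 'm \<Rightarrow> real set" where
  "eigenvalues A = {c. \<exists>v. v \<noteq> 0 \<and> A *v v = c *s v}"

(* Intended for symmetric A, where eigenvalues A is finite and nonempty *)
definition min_eigenvalue :: "real ^ 'm ^ 'm \<Rightarrow> real" where
  "min_eigenvalue A = Min (eigenvalues A)"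

(* C^p regularity on the whole space, through iterated directional derivatives *)
fun C_diff :: "nat \<Rightarrow> ('a::real_normed_vector \<Rightarrow> 'b::real_normed_vector) \<Rightarrow> bool" where
  "C_diff 0 f \<longleftrightarrow> continuous_on UNIV f"
| "C_diff (Suc p) f \<longleftrightarrow>
     (\<forall>x. f differentiable (at x)) \<and> (\<forall>d. C_diff p (\<lambda>x. frechet_derivative f (at x) d))"

definition smooth :: "('a::real_normed_vector \<Rightarrow> 'b::real_normed_vector) \<Rightarrow> bool" where
  "smooth f \<longleftrightarrow> (\<forall>p. C_diff p f)"

definition G1 ::
    "(real ^ 'n \<Rightarrow> real ^ 'm::finite option) \<Rightarrow> (real ^ 'n \<Rightarrow> real ^ 'k ^ 'm option) \<Rightarrow>
     real ^ 'n \<Rightarrow> real ^ 'm option \<Rightarrow> real ^ 'k \<Rightarrow> real" where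
  "G1 q1 R1 x u \<zeta> = u \<bullet> q1 x + u \<bullet> (R1 x *v \<zeta>)"

(* The feasible points (u, y, t, s) of the DRO-SOCP with M = 1 at x; the values of s and \<xi>
   outside {1..N} are irrelevant. *)
definition dro_socp_feasible_set ::
    "nat \<Rightarrow> real \<Rightarrow> real \<Rightarrow> (nat \<Rightarrow> real ^ 'k) \<Rightarrow>
     (real ^ 'n \<Rightarrow> real ^ 'm::finite option) \<Rightarrow> (real ^ 'n \<Rightarrow> real ^ 'k ^ 'm option) \<Rightarrow>
     (real ^ 'n \<Rightarrow> real ^ 'm option) \<Rightarrow> real ^ 'n \<Rightarrow>
     ((real ^ 'm option) \<times> real \<times> real \<times> (nat \<Rightarrow> real)) set" where
  "dro_socp_feasible_set N r \<epsilon> \<xi> q1 R1 ku x = {(u, y, t, s).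
     u \<in> augmented_inputs \<and>
     r * norm (transpose (R1 x) *v u) + (1 / real N) * (\<Sum>i=1..N. s i) - t * \<epsilon> \<le> 0 \<and>
     (\<forall>i\<in>{1..N}. s i \<ge> G1 q1 R1 x u (\<xi> i) + t \<and> s i \<ge> 0) \<and>
     y + 1 \<ge> sqrt ((norm (2 *\<^sub>R (u - ku x)))\<^sup>2 + (y - 1)\<^sup>2)}"

definition dro_socp_feasible ::
    "nat \<Rightarrow> real \<Rightarrow> real \<Rightarrow> (nat \<Rightarrow> real ^ 'k) \<Rightarrow>
     (real ^ 'n \<Rightarrow> real ^ 'm::finite option) \<Rightarrow> (real ^ 'n \<Rightarrow> real ^ 'k ^ 'm option) \<Rightarrow>
     (real ^ 'n \<Rightarrow> real ^ 'm option) \<Rightarrow> real ^ 'n \<Rightarrow> bool" where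
  "dro_socp_feasible N r \<epsilon> \<xi> q1 R1 ku x \<longleftrightarrow> dro_socp_feasible_set N r \<epsilon> \<xi> q1 R1 ku x \<noteq> {}"

end

theory Submission
  imports Defs
begin

text \<open>
  \<^bold>\<open>Reduction.\<close> Write an input as \<open>[1; z]\<close>. With all \<open>s i = 0\<close>, with \<open>t\<close> the negative of the
  Cauchy--Schwarz bound on the values of \<open>G1\<close> at the samples, and with \<open>y\<close> the squared distance to
  \<open>ku x\<close>, the SOCP is feasible as soon as some \<open>z\<close> satisfies the single cone constraint
  \<open>norm (Q\<^sup>T z + rh) \<le> w \<bullet> z + v\<close>; that is, \<open>0 \<le> w \<bullet> z + v\<close> and \<open>p z \<le> 0\<close> for the quadratic
  polynomial \<open>p z = z \<bullet> F z + 2 (J \<bullet> z) + (rh \<bullet> rh - v\<^sup>2)\<close>, whose homogenization has matrix \<open>H\<close>.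

  \<^bold>\<open>Solving the cone constraint.\<close> As \<open>F\<close> is symmetric, its least eigenvalue is the minimum of the
  Rayleigh quotient, so its sign decides the shape of \<open>p\<close>.
  \<^item> If it is negative, some direction \<open>z\<close> has \<open>norm (Q\<^sup>T z) < w \<bullet> z\<close>, and going far enough along it
    absorbs the constants \<open>rh\<close> and \<open>v\<close> (\<open>cone_feasible_negative_direction\<close>).
  \<^item> If it is positive, \<open>p\<close> has the minimizer \<open>- F\<^sup>-\<^sup>1 J\<close>, at which its value is the Schur complement of
    \<open>F\<close> in \<open>H\<close>; this is nonpositive because \<open>H\<close> is not positive definite, and hypothesis (ii) says
    exactly that the minimizer lies on the right side of the cone (\<open>cone_feasible_positive\<close>).
  \<^item> If it is zero, the kernel of \<open>F\<close> contains \<open>e = (Q Q\<^sup>T)\<^sup>-\<^sup>1 w\<close>, normalized by \<open>w \<bullet> e = 1\<close>. Along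
    \<open>e\<close> the quadratic terms cancel, \<open>p\<close> is affine, and hypothesis (iii) says that its slope is
    negative (\<open>cone_feasible_kernel_direction\<close>).
\<close>

section \<open>Matrix inverses and adjoints\<close>

lemma matrix_inv_invertible:
  assumes "invertible A"
  shows "A ** matrix_inv A = mat 1" and "matrix_inv A ** A = mat 1"
  using someI_ex[of "\<lambda>B. A ** B = mat 1 \<and> B ** A = mat 1"] assms
  unfolding invertible_def matrix_inv_def by blast+

lemma mult_matrix_inv_vec:
  fixes A :: "real ^ 'm ^ 'm"
  assumes "invertible A"
  shows "A *v (matrix_inv A *v b) = b"
  by (simp only: matrix_vector_mul_assoc matrix_inv_invertible[OF assms] matrix_vector_mul_lid)

lemma matrix_vector_mult_minus:
  fixes A :: "real ^ 'n ^ 'm"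
  shows "A *v (- z) = - (A *v z)"
  using matrix_vector_mult_scaleR[of A "-1" z] by simp

lemma symmetric_inner:
  fixes A :: "real ^ 'm ^ 'm"
  assumes "transpose A = A"
  shows "a \<bullet> (A *v b) = (A *v a) \<bullet> b"
  by (metis assms dot_lmul_matrix transpose_matrix_vector)

section \<open>The least eigenvalue of a symmetric matrix\<close>

text \<open>Eigenvectors for distinct eigenvalues are orthogonal, hence linearly independent.\<close>

lemma finite_eigenvalues_symmetric:
  fixes A :: "real ^ 'm ^ 'm"
  assumes sym: "transpose A = A"
  shows "finite (eigenvalues A)"
proof -
  define f where "f c = (SOME v. v \<noteq> 0 \<and> A *v v = c *s v)" for c
  have f: "f c \<noteq> 0 \<and> A *v f c = c *s f c" if "c \<in> eigenvalues A" for c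
    using that someI_ex[of "\<lambda>v. v \<noteq> 0 \<and> A *v v = c *s v"]
    unfolding f_def eigenvalues_def by blast
  have orth: "f c \<bullet> f d = 0" if "c \<in> eigenvalues A" "d \<in> eigenvalues A" "c \<noteq> d" for c d
  proof -
    have "d * (f c \<bullet> f d) = c * (f c \<bullet> f d)"
      using symmetric_inner[OF sym, of "f c" "f d"] f[OF that(1)] f[OF that(2)]
      by (simp add: scalar_mult_eq_scaleR)
    then show ?thesis using that(3) by simp
  qed
  have inj: "inj_on f (eigenvalues A)"
    by (rule inj_onI) (metis f inner_eq_zero_iff orth)
  have "pairwise orthogonal (f ` eigenvalues A)"
    using orth by (auto simp: pairwise_def orthogonal_def)
  moreover have "0 \<notin> f ` eigenvalues A" using f by force
  ultimately have "finite (f ` eigenvalues A)"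
    using pairwise_orthogonal_independent independent_imp_finite by blast
  then show ?thesis using inj finite_imageD by blast
qed

text \<open>
  A null vector of a nonnegative quadratic form is a minimizer of the form, so the gradient
  vanishes there.
\<close>

lemma psd_null_vector:
  fixes A :: "real ^ 'm ^ 'm"
  assumes sym: "transpose A = A"
    and psd: "\<And>a. 0 \<le> a \<bullet> (A *v a)" and null: "b \<bullet> (A *v b) = 0"
  shows "A *v b = 0"
proof (rule ccontr)
  assume nz: "A *v b \<noteq> 0"
  define g where "g = A *v b"
  define \<alpha> where "\<alpha> = g \<bullet> g"
  define \<beta> where "\<beta> = g \<bullet> (A *v g)"
  have \<alpha>: "\<alpha> > 0" using nz by (simp add: \<alpha>_def g_def)
  have \<beta>: "\<beta> \<ge> 0" using psd by (simp add: \<beta>_def)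
  have bg: "b \<bullet> (A *v g) = \<alpha>"
    by (simp add: symmetric_inner[OF sym] \<alpha>_def g_def)
  have expand: "(b - h *\<^sub>R g) \<bullet> (A *v (b - h *\<^sub>R g)) = h * (h * \<beta> - 2 * \<alpha>)" for h
    using null bg
    by (simp add: matrix_vector_mult_diff_distrib matrix_vector_mult_scaleR inner_diff_left
        inner_diff_right \<alpha>_def \<beta>_def flip: g_def) (simp add: algebra_simps)
  \<comment> \<open>Essentially the minimizer of the form along \<open>b - h g\<close>; the summand 1 covers \<open>\<beta> = 0\<close>.\<close>
  define h where "h = \<alpha> / (\<beta> + 1)"
  have h: "h > 0" using \<alpha> \<beta> by (simp add: h_def)
  have "h * \<beta> \<le> \<alpha>"
    using \<alpha> \<beta> by (simp add: h_def field_simps)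
  then have "h * (h * \<beta> - 2 * \<alpha>) < 0"
    using h \<alpha> by (simp add: mult_pos_neg)
  then show False using psd[of "b - h *\<^sub>R g"] expand by simp
qed

text \<open>
  By compactness the quadratic form has a minimum on the unit sphere, and subtracting this minimum
  times the identity turns a minimizer into a null vector of a nonnegative form, hence into an
  eigenvector.
\<close>

lemma min_eigenvalue_symmetric:
  fixes A :: "real ^ 'm ^ 'm"
  assumes sym: "transpose A = A"
  obtains b where "b \<noteq> 0" "A *v b = min_eigenvalue A *\<^sub>R b"
    "\<And>a. min_eigenvalue A * (a \<bullet> a) \<le> a \<bullet> (A *v a)"
proof -
  have cont: "continuous_on (sphere 0 1) (\<lambda>a. a \<bullet> (A *v a))"
    by (intro continuous_intros linear_continuous_on_compose[where g="(*v) A"]) auto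
  have "sphere (0 :: real ^ 'm) 1 \<noteq> {}" by simp
  then obtain b where b: "norm b = 1"
    and min: "\<And>a. norm a = 1 \<Longrightarrow> b \<bullet> (A *v b) \<le> a \<bullet> (A *v a)"
    using continuous_attains_inf[OF compact_sphere _ cont] by (auto simp: dist_norm)
  define \<mu> where "\<mu> = b \<bullet> (A *v b)"
  have ray: "\<mu> * (a \<bullet> a) \<le> a \<bullet> (A *v a)" for a
  proof (cases "a = 0")
    case False
    then have "\<mu> \<le> (a /\<^sub>R norm a) \<bullet> (A *v (a /\<^sub>R norm a))"
      unfolding \<mu>_def by (intro min) simp
    also have "\<dots> = (a \<bullet> (A *v a)) / (a \<bullet> a)"
      by (simp add: matrix_vector_mult_scaleR dot_square_norm power2_eq_square divide_simps)
    finally show ?thesis using False by (simp add: field_simps)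
  qed simp
  define B where "B = A - \<mu> *\<^sub>R mat 1"
  have B: "B *v a = A *v a - \<mu> *\<^sub>R a" for a
    by (simp add: B_def matrix_vector_mult_diff_rdistrib scaleR_matrix_vector_assoc[symmetric])
  have "transpose B = B"
    using sym by (simp add: B_def vec_eq_iff transpose_def mat_def)
  moreover have "0 \<le> a \<bullet> (B *v a)" for a
    using ray by (simp add: B inner_diff_right)
  moreover have "b \<bullet> (B *v b) = 0"
    using b by (simp add: B inner_diff_right \<mu>_def dot_square_norm)
  ultimately have "B *v b = 0" by (rule psd_null_vector)
  then have eig: "A *v b = \<mu> *\<^sub>R b" by (simp add: B)
  have b0: "b \<noteq> 0" using b by auto
  have "min_eigenvalue A = \<mu>"
    unfolding min_eigenvalue_def
  proof (rule Min_eqI[OF finite_eigenvalues_symmetric[OF sym]])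
    show "\<mu> \<in> eigenvalues A"
      using b0 eig by (auto simp: eigenvalues_def scalar_mult_eq_scaleR)
    fix c assume "c \<in> eigenvalues A"
    then obtain a where a: "a \<noteq> 0" "A *v a = c *\<^sub>R a"
      by (auto simp: eigenvalues_def scalar_mult_eq_scaleR)
    then show "\<mu> \<le> c" using ray[of a] by simp
  qed
  then show thesis using that b0 eig ray by simp
qed

section \<open>Block vectors and bordered matrices\<close>

definition block_vec :: "real \<Rightarrow> real ^ 'm \<Rightarrow> real ^ 'm::finite option" where
  "block_vec a z = (\<chi> i. case i of None \<Rightarrow> a | Some j \<Rightarrow> z $ j)"

lemma block_vec_None [simp]: "block_vec a z $ None = a"
  and block_vec_Some [simp]: "block_vec a z $ Some j = z $ j"
  by (simp_all add: block_vec_def)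

lemma tail_rows_block_vec [simp]: "tail_rows (block_vec a z) = z"
  by (simp add: tail_rows_def vec_eq_iff)

lemma block_vec_tail_rows: "block_vec (u $ None) (tail_rows u) = u"
  by (simp add: block_vec_def tail_rows_def vec_eq_iff split: option.split)

lemma sum_UNIV_option:
  fixes g :: "'m::finite option \<Rightarrow> 'b::comm_monoid_add"
  shows "sum g UNIV = g None + (\<Sum>i\<in>UNIV. g (Some i))"
  by (simp add: UNIV_option_conv sum.reindex)

lemma block_vec_inner: "block_vec a z \<bullet> u = a * u $ None + z \<bullet> tail_rows u"
  by (simp add: inner_vec_def sum_UNIV_option tail_rows_def)

lemma transpose_block_vec:
  "transpose R *v block_vec a z = a *\<^sub>R (R $ None) + transpose (tail_rows R) *v z"
  by (simp add: vec_eq_iff matrix_vector_mult_def transpose_def sum_UNIV_option tail_rows_def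
      mult.commute)

lemma bordered_matrix_block_vec:
  "bordered_matrix c b C *v block_vec a z = block_vec (c * a + b \<bullet> z) (a *\<^sub>R b + C *v z)"
proof -
  have "(bordered_matrix c b C *v block_vec a z) $ i = block_vec (c * a + b \<bullet> z) (a *\<^sub>R b + C *v z) $ i"
    for i
    by (cases i) (simp_all add: bordered_matrix_def matrix_vector_mult_def sum_UNIV_option
        inner_vec_def mult.commute)
  then show ?thesis by (simp add: vec_eq_iff)
qed

lemma transpose_bordered_matrix:
  assumes "transpose C = C"
  shows "transpose (bordered_matrix c b C) = bordered_matrix c b C"
proof -
  have C: "C $ i $ j = C $ j $ i" for i j
    by (metis assms transpose_def vec_lambda_beta)
  have "transpose (bordered_matrix c b C) $ i $ j = bordered_matrix c b C $ i $ j" for i j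
    by (cases i; cases j) (simp_all add: transpose_def bordered_matrix_def C)
  then show ?thesis by (simp add: vec_eq_iff)
qed

text \<open>
  With \<open>C y = b\<close>, the number \<open>c - b \<bullet> y\<close> is the Schur complement of \<open>C\<close>. Completing the square
  writes the form of the bordered matrix at \<open>[a; z]\<close> as the form of \<open>C\<close> at \<open>z + a y\<close> plus \<open>a\<^sup>2\<close> times
  this number.
\<close>

lemma positive_definite_bordered_matrix:
  assumes sym: "transpose C = C" and pd: "\<And>z. z \<noteq> 0 \<Longrightarrow> 0 < z \<bullet> (C *v z)"
    and y: "C *v y = b" and schur: "0 < c - b \<bullet> y"
  shows "positive_definite (bordered_matrix c b C)"
  unfolding positive_definite_def
proof (intro conjI allI impI)
  fix u :: "real ^ 'a option" assume "u \<noteq> 0"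
  define a where "a = u $ None"
  define z where "z = tail_rows u"
  have u: "u = block_vec a z" by (simp add: a_def z_def block_vec_tail_rows)
  have nz: "a \<noteq> 0 \<or> z \<noteq> 0"
    using \<open>u \<noteq> 0\<close> unfolding u by (auto simp: block_vec_def vec_eq_iff split: option.splits)
  have "y \<bullet> (C *v z) = b \<bullet> z" by (simp add: symmetric_inner[OF sym] y)
  then have "u \<bullet> (bordered_matrix c b C *v u)
      = (z + a *\<^sub>R y) \<bullet> (C *v (z + a *\<^sub>R y)) + a\<^sup>2 * (c - b \<bullet> y)"
    by (simp add: u bordered_matrix_block_vec block_vec_inner matrix_vector_right_distrib
        matrix_vector_mult_scaleR y inner_add_left inner_add_right inner_commute power2_eq_square)
      (simp add: algebra_simps inner_commute)
  also have "\<dots> > 0"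
  proof (cases "a = 0")
    case True then show ?thesis using nz pd by simp
  next
    case False
    have "0 \<le> (z + a *\<^sub>R y) \<bullet> (C *v (z + a *\<^sub>R y))"
      using pd by (cases "z + a *\<^sub>R y = 0") (auto intro: less_imp_le)
    then show ?thesis using False schur by (simp add: add_nonneg_pos)
  qed
  finally show "u \<bullet> (bordered_matrix c b C *v u) > 0" .
qed (rule transpose_bordered_matrix[OF sym])

section \<open>The cone constraint\<close>

lemma outer_prod_mult_vec: "outer_prod a b *v z = (b \<bullet> z) *\<^sub>R a"
  by (simp add: vec_eq_iff outer_prod_def matrix_vector_mult_def inner_vec_def
      sum_distrib_left sum_distrib_right mult_ac)

lemma gram_minus_outer_mult_vec:
  fixes Q :: "real ^ 'k ^ 'm" and w :: "real ^ 'm"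
  shows "(Q ** transpose Q - outer_prod w w) *v z
    = Q *v (transpose Q *v z) - (w \<bullet> z) *\<^sub>R w"
  by (simp only: matrix_vector_mult_diff_rdistrib outer_prod_mult_vec matrix_vector_mul_assoc)

lemma transpose_gram_minus_outer:
  fixes Q :: "real ^ 'k ^ 'm" and w :: "real ^ 'm"
  shows "transpose (Q ** transpose Q - outer_prod w w) = Q ** transpose Q - outer_prod w w"
  by (simp add: vec_eq_iff transpose_def matrix_matrix_mult_def outer_prod_def mult.commute)

lemma inner_transpose_mult:
  fixes Q :: "real ^ 'k ^ 'm"
  shows "(transpose Q *v z) \<bullet> b = z \<bullet> (Q *v b)"
  by (simp add: dot_lmul_matrix)

text \<open>The strict inequality leaves a gap that grows linearly along the ray spanned by \<open>z\<close>.\<close>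

lemma cone_feasible_negative_direction:
  fixes Q :: "real ^ 'k ^ 'm" and w :: "real ^ 'm"
  assumes neg: "z \<bullet> ((Q ** transpose Q - outer_prod w w) *v z) < 0"
  shows "\<exists>z. norm (transpose Q *v z + b) \<le> w \<bullet> z + v"
proof -
  have "(norm (transpose Q *v z))\<^sup>2 < (w \<bullet> z)\<^sup>2"
    using neg by (simp only: gram_minus_outer_mult_vec inner_diff_right inner_transpose_mult
        power2_norm_eq_inner) (simp add: power2_eq_square inner_commute)
  then have "norm (transpose Q *v z) < \<bar>w \<bullet> z\<bar>"
    using abs_le_square_iff[of "w \<bullet> z" "norm (transpose Q *v z)"] by simp
  moreover define z' where "z' = (if w \<bullet> z < 0 then - z else z)"
  ultimately have lt: "norm (transpose Q *v z') < w \<bullet> z'"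
    using matrix_vector_mult_minus[of "transpose Q" z] by (auto split: if_splits)
  define d where "d = w \<bullet> z' - norm (transpose Q *v z')"
  define s where "s = (norm b + \<bar>v\<bar>) / d"
  have d: "d > 0" and s: "s \<ge> 0" using lt by (simp_all add: d_def s_def)
  have "norm (transpose Q *v (s *\<^sub>R z') + b) \<le> s * norm (transpose Q *v z') + norm b"
    using s norm_triangle_ineq[of "transpose Q *v (s *\<^sub>R z')" b]
    by (simp add: matrix_vector_mult_scaleR)
  also have "\<dots> = s * (w \<bullet> z') - s * d + norm b" by (simp add: d_def algebra_simps)
  also have "\<dots> \<le> w \<bullet> (s *\<^sub>R z') + v" using d by (simp add: s_def)
  finally show ?thesis by blast
qed

lemma cone_defect:
  fixes Q :: "real ^ 'k ^ 'm" and w z :: "real ^ 'm"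
  shows "(norm (transpose Q *v z + b))\<^sup>2 - (w \<bullet> z + v)\<^sup>2
    = z \<bullet> ((Q ** transpose Q - outer_prod w w) *v z) + 2 * (z \<bullet> (Q *v b - v *\<^sub>R w))
      + (b \<bullet> b - v\<^sup>2)"
proof -
  have "(norm (transpose Q *v z + b))\<^sup>2 = z \<bullet> (Q *v (transpose Q *v z)) + 2 * (z \<bullet> (Q *v b)) + b \<bullet> b"
    by (simp only: power2_norm_eq_inner inner_add_left inner_add_right inner_transpose_mult
        inner_commute[of b "transpose Q *v z"])
  then show ?thesis
    by (simp only: gram_minus_outer_mult_vec inner_diff_right)
      (simp add: power2_eq_square algebra_simps inner_commute)
qed

lemma cone_feasible_positive:
  fixes Q :: "real ^ 'k ^ 'm" and w :: "real ^ 'm"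
  defines "F \<equiv> Q ** transpose Q - outer_prod w w"
  assumes pd: "\<And>z. z \<noteq> 0 \<Longrightarrow> 0 < z \<bullet> (F *v z)"
    and nonpd: "\<not> positive_definite (bordered_matrix (b \<bullet> b - v\<^sup>2) (Q *v b - v *\<^sub>R w) F)"
    and side: "0 \<le> v - w \<bullet> (matrix_inv F *v (Q *v b - v *\<^sub>R w))"
  shows "\<exists>z. norm (transpose Q *v z + b) \<le> w \<bullet> z + v"
proof -
  define J where "J = Q *v b - v *\<^sub>R w"
  define y where "y = matrix_inv F *v J"
  have "\<And>z. F *v z = 0 \<Longrightarrow> z = 0"
    using pd by (metis inner_zero_right less_irrefl)
  then have "invertible F"
    using matrix_left_invertible_ker invertible_left_inverse by blast
  then have y: "F *v y = J"
    unfolding y_def by (rule mult_matrix_inv_vec)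
  have "(b \<bullet> b - v\<^sup>2) - J \<bullet> y \<le> 0"
  proof (rule ccontr)
    assume "\<not> (b \<bullet> b - v\<^sup>2) - J \<bullet> y \<le> 0"
    then have "positive_definite (bordered_matrix (b \<bullet> b - v\<^sup>2) J F)"
      using transpose_gram_minus_outer pd y
      by (intro positive_definite_bordered_matrix) (auto simp: F_def)
    then show False using nonpd by (simp add: J_def)
  qed
  moreover have "(norm (transpose Q *v (- y) + b))\<^sup>2 - (w \<bullet> (- y) + v)\<^sup>2 = (b \<bullet> b - v\<^sup>2) - J \<bullet> y"
    unfolding cone_defect F_def[symmetric] J_def[symmetric]
    by (simp add: matrix_vector_mult_minus y inner_commute)
  ultimately have "(norm (transpose Q *v (- y) + b))\<^sup>2 \<le> (w \<bullet> (- y) + v)\<^sup>2" by linarith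
  moreover have "0 \<le> w \<bullet> (- y) + v" using side by (simp add: y_def J_def)
  ultimately show ?thesis by (blast intro: power2_le_imp_le)
qed

text \<open>
  A null vector \<open>e\<close> of \<open>F\<close> satisfies \<open>Q Q\<^sup>T e = (w \<bullet> e) w\<close>, and \<open>w \<bullet> e \<noteq> 0\<close> because \<open>Q Q\<^sup>T\<close> is injective;
  normalizing gives \<open>w \<bullet> e = 1\<close>. On the ray spanned by \<open>e\<close> the defect of the squared constraint is
  affine with slope \<open>- 2 (v - w \<bullet> (Q Q\<^sup>T)\<^sup>-\<^sup>1 Q b)\<close>.
\<close>

lemma cone_feasible_kernel_direction:
  fixes Q :: "real ^ 'k ^ 'm" and w :: "real ^ 'm"
  assumes inv: "invertible (Q ** transpose Q)"
    and e0: "e0 \<noteq> 0" "(Q ** transpose Q - outer_prod w w) *v e0 = 0"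
    and slope: "0 < v - w \<bullet> (matrix_inv (Q ** transpose Q) *v (Q *v b))"
  shows "\<exists>z. norm (transpose Q *v z + b) \<le> w \<bullet> z + v"
proof -
  define A where "A = Q ** transpose Q"
  define F where "F = A - outer_prod w w"
  have symA: "transpose A = A"
    by (simp add: A_def matrix_transpose_mul)
  have Ae0: "A *v e0 = (w \<bullet> e0) *\<^sub>R w"
    using e0(2) by (simp add: A_def matrix_vector_mult_diff_rdistrib outer_prod_mult_vec)
  have we0: "w \<bullet> e0 \<noteq> 0"
  proof
    assume "w \<bullet> e0 = 0"
    then have "A *v e0 = 0" using Ae0 by simp
    then have "matrix_inv A ** A *v e0 = 0" by (simp flip: matrix_vector_mul_assoc)
    then show False using e0(1) inv by (simp add: A_def matrix_inv_invertible)
  qed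
  define e where "e = e0 /\<^sub>R (w \<bullet> e0)"
  have we: "w \<bullet> e = 1" and Ae: "A *v e = w" and Fe: "F *v e = 0"
    using we0 Ae0 e0(2) by (simp_all add: e_def F_def A_def matrix_vector_mult_scaleR)
  define y where "y = matrix_inv A *v (Q *v b)"
  have "A *v y = Q *v b"
    using inv unfolding y_def A_def by (rule mult_matrix_inv_vec)
  then have "e \<bullet> (Q *v b) = w \<bullet> y"
    using symmetric_inner[OF symA, of e y] Ae by simp
  moreover define g where "g = v - w \<bullet> y"
  ultimately have slope_e: "e \<bullet> (Q *v b - v *\<^sub>R w) = - g"
    using we by (simp add: inner_diff_right inner_commute)
  have g: "g > 0" using slope by (simp add: g_def y_def A_def)
  \<comment> \<open>The term \<open>\<bar>v\<bar>\<close> keeps \<open>s + v\<close> nonnegative; the second term makes the slope outweigh \<open>b \<bullet> b\<close>.\<close>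
  define s where "s = \<bar>v\<bar> + (b \<bullet> b) / (2 * g)"
  have "(norm (transpose Q *v (s *\<^sub>R e) + b))\<^sup>2 - (w \<bullet> (s *\<^sub>R e) + v)\<^sup>2
      = - 2 * s * g + (b \<bullet> b - v\<^sup>2)"
    unfolding cone_defect A_def[symmetric] F_def[symmetric]
    by (simp add: matrix_vector_mult_scaleR Fe slope_e)
  also have "\<dots> = - 2 * \<bar>v\<bar> * g - v\<^sup>2"
    using g by (simp add: s_def field_simps)
  also have "\<dots> \<le> 0"
    using mult_nonneg_nonneg[of "\<bar>v\<bar>" g] zero_le_power2[of v] g by linarith
  finally have "(norm (transpose Q *v (s *\<^sub>R e) + b))\<^sup>2 \<le> (w \<bullet> (s *\<^sub>R e) + v)\<^sup>2" by simp
  moreover have "0 \<le> w \<bullet> (s *\<^sub>R e) + v"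
  proof -
    have "0 \<le> (b \<bullet> b) / (2 * g)" using g by simp
    then show ?thesis by (simp add: we s_def)
  qed
  ultimately show ?thesis by (blast intro: power2_le_imp_le)
qed

section \<open>Reduction of the SOCP to the cone constraint\<close>

text \<open>
  With \<open>s = 0\<close> the best choice is \<open>t = - max G1\<close>; Cauchy--Schwarz bounds every \<open>G1\<close> by
  \<open>u \<bullet> q1 x + norm (R\<^sup>T u) M\<close>, which may be used in its place. The value
  \<open>y = (norm (u - ku x))\<^sup>2\<close> makes the last constraint an equality.
\<close>

lemma dro_socp_feasibleI:
  assumes "u $ None = 1"
    and M: "\<And>i. i \<in> {1..N} \<Longrightarrow> norm (\<xi> i) \<le> M"
    and cone: "(r + \<epsilon> * M) * norm (transpose (R1 x) *v u) \<le> - \<epsilon> * (u \<bullet> q1 x)"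
  shows "dro_socp_feasible N r \<epsilon> \<xi> q1 R1 ku x"
proof -
  define nR where "nR = norm (transpose (R1 x) *v u)"
  define t where "t = - (u \<bullet> q1 x + nR * M)"
  define y where "y = (norm (u - ku x))\<^sup>2"
  have G: "G1 q1 R1 x u (\<xi> i) + t \<le> 0" if "i \<in> {1..N}" for i
  proof -
    have "u \<bullet> (R1 x *v \<xi> i) \<le> nR * norm (\<xi> i)"
      unfolding nR_def inner_transpose_mult[symmetric] by (rule norm_cauchy_schwarz)
    also have "\<dots> \<le> nR * M" using M[OF that] by (simp add: nR_def mult_left_mono)
    finally show ?thesis by (simp add: G1_def t_def)
  qed
  have "(norm (2 *\<^sub>R (u - ku x)))\<^sup>2 + (y - 1)\<^sup>2 = (y + 1)\<^sup>2"
    by (simp add: y_def power_mult_distrib) (simp add: power2_eq_square algebra_simps)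
  then have soc: "y + 1 \<ge> sqrt ((norm (2 *\<^sub>R (u - ku x)))\<^sup>2 + (y - 1)\<^sup>2)"
    by (simp add: y_def)
  have "r * nR - t * \<epsilon> \<le> 0"
    using cone by (simp add: t_def nR_def algebra_simps)
  then have "(u, y, t, \<lambda>_. 0) \<in> dro_socp_feasible_set N r \<epsilon> \<xi> q1 R1 ku x"
    using assms(1) G soc by (simp add: dro_socp_feasible_set_def augmented_inputs_def nR_def)
  then show ?thesis unfolding dro_socp_feasible_def by blast
qed

theorem mainTheorem2:
  fixes N :: nat and r \<epsilon> \<rho> v :: real
    and \<xi> :: "nat \<Rightarrow> real ^ 'k"
    and q1 :: "real ^ 'n \<Rightarrow> real ^ 'm::finite option"
    and R1 :: "real ^ 'n \<Rightarrow> real ^ 'k ^ 'm option"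
    and ku :: "real ^ 'n \<Rightarrow> real ^ 'm option"
    and x :: "real ^ 'n"
    and Q :: "real ^ 'k ^ 'm" and rh :: "real ^ 'k" and w J :: "real ^ 'm"
    and F :: "real ^ 'm ^ 'm" and H :: "real ^ 'm option ^ 'm option"
  assumes "N \<ge> 1" and "r > 0" and "0 < \<epsilon>" and "\<epsilon> \<le> 1 / real N"
    and "smooth q1" and "smooth R1" and "smooth ku"
    and "\<And>z. ku z \<in> augmented_inputs"
    and "\<rho> = r + \<epsilon> * Max ((\<lambda>i. norm (\<xi> i)) ` {1..N})"
    and "Q = \<rho> *\<^sub>R tail_rows (R1 x)"
    and "rh = \<rho> *\<^sub>R (R1 x $ None)"
    and "w = - \<epsilon> *\<^sub>R tail_rows (q1 x)"
    and "v = - \<epsilon> * (q1 x $ None)"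
    and "F = Q ** transpose Q - outer_prod w w"
    and "J = rh v* transpose Q - v *\<^sub>R w"
    and "H = bordered_matrix (rh \<bullet> rh - v\<^sup>2) J F"
    and "invertible (Q ** transpose Q)"
    and "\<not> positive_definite H"
    and "min_eigenvalue F < 0
         \<or> (min_eigenvalue F > 0 \<and> v - w \<bullet> (matrix_inv F *v (Q *v rh - v *\<^sub>R w)) \<ge> 0)
         \<or> (min_eigenvalue F = 0 \<and> v - w \<bullet> (matrix_inv (Q ** transpose Q) *v (Q *v rh)) > 0)"
  shows "dro_socp_feasible N r \<epsilon> \<xi> q1 R1 ku x"
proof -
  define M where "M = Max ((\<lambda>i. norm (\<xi> i)) ` {1..N})"
  have M: "norm (\<xi> i) \<le> M" if "i \<in> {1..N}" for i
    unfolding M_def using that by (intro Max_ge) auto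
  have "0 \<le> norm (\<xi> 1)" by simp
  also have "\<dots> \<le> M" using assms(1) by (intro M) simp
  finally have \<rho>: "\<rho> > 0" using assms(2,3,9) by (simp add: M_def add_pos_nonneg)
  have sym: "transpose F = F" unfolding assms(14) by (rule transpose_gram_minus_outer)
  have J: "J = Q *v rh - v *\<^sub>R w"
    by (simp add: assms(15) flip: transpose_matrix_vector)
  obtain b where b: "b \<noteq> 0" "F *v b = min_eigenvalue F *\<^sub>R b"
    and ray: "\<And>a. min_eigenvalue F * (a \<bullet> a) \<le> a \<bullet> (F *v a)"
    using min_eigenvalue_symmetric[OF sym] by blast
  have "\<exists>z. norm (transpose Q *v z + rh) \<le> w \<bullet> z + v"
    using assms(19)
  proof (elim disjE conjE)
    assume "min_eigenvalue F < 0"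
    then have "b \<bullet> (F *v b) < 0" using b by (simp add: mult_neg_pos)
    then show ?thesis unfolding assms(14) by (rule cone_feasible_negative_direction)
  next
    assume "min_eigenvalue F > 0"
    then have pd: "0 < z \<bullet> (F *v z)" if "z \<noteq> 0" for z
      using ray[of z] that by (smt (verit) inner_gt_zero_iff mult_pos_pos)
    assume "0 \<le> v - w \<bullet> (matrix_inv F *v (Q *v rh - v *\<^sub>R w))"
    then show ?thesis
      using pd assms(18) unfolding assms(16) J assms(14) by (intro cone_feasible_positive)
  next
    assume "min_eigenvalue F = 0"
    then have "F *v b = 0" using b by simp
    moreover assume "0 < v - w \<bullet> (matrix_inv (Q ** transpose Q) *v (Q *v rh))"
    ultimately show ?thesis
      using assms(17) b(1) unfolding assms(14) by (intro cone_feasible_kernel_direction)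
  qed
  then obtain z where z: "norm (transpose Q *v z + rh) \<le> w \<bullet> z + v" by blast
  have "transpose Q *v z + rh = \<rho> *\<^sub>R (transpose (R1 x) *v block_vec 1 z)"
    by (simp only: assms(10,11) transpose_block_vec transpose_scalar scaleR_right_distrib
        scaleR_matrix_vector_assoc scaleR_one add.commute)
  moreover have "w \<bullet> z + v = - \<epsilon> * (block_vec 1 z \<bullet> q1 x)"
    by (simp add: assms(12,13) block_vec_inner inner_commute[of _ z] distrib_left)
  ultimately have "\<rho> * norm (transpose (R1 x) *v block_vec 1 z) \<le> - \<epsilon> * (block_vec 1 z \<bullet> q1 x)"
    using z \<rho> by simp
  then have "(r + \<epsilon> * M) * norm (transpose (R1 x) *v block_vec 1 z)
      \<le> - \<epsilon> * (block_vec 1 z \<bullet> q1 x)"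
    by (simp only: assms(9) M_def)
  then show ?thesis
    by (intro dro_socp_feasibleI[where u = "block_vec 1 z" and M = M] M block_vec_None)
qed

end
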